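(* Let $\mathcal{B}\in\mathsf{LTI}^{m,p}$ have a state-space realization $x(t+1)=Ax(t)+Bu(t)$, $y(t)=Cx(t)+Du(t)$. Let $T_{\mathrm{ini}},T_{\mathrm f}\in\mathbb{Z}_{\ge0}$. Suppose $(u^{\mathrm{ini}},y^{\mathrm{ini}})\in\mathcal{B}_{[0,T_{\mathrm{ini}}-1]}$ and $u^{\mathrm f}\in\mathbb{R}^{mT_{\mathrm f}}$. Then there exists a unique $y^{\mathrm f}\in\mathbb{R}^{pT_{\mathrm f}}$ such that $(u^{\mathrm{ini}},u^{\mathrm f},y^{\mathrm{ini}},y^{\mathrm f})\in\mathcal{B}_{[0,T_{\mathrm{ini}}+T_{\mathrm f}-1]}$ if and only if $T_{\mathrm{ini}}\ge\ell(\mathcal{B})$.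
   Context: **Behaviors.** Consider linear time-invariant systems $x(t+1)=Ax(t)+Bu(t)$, $y(t)=Cx(t)+Du(t)$, $t\in\mathbb{Z}_{\ge0}$, with real matrices $A\in\mathbb{R}^{n\times n}$, $B\in\mathbb{R}^{n\times m}$, $C\in\mathbb{R}^{p\times n}$, $D\in\mathbb{R}^{p\times m}$. The behavior of the system is $\mathcal{B}=\{(u,y)\in(\mathbb{R}^m)^{\mathbb{Z}_{\ge0}}\times(\mathbb{R}^p)^{\mathbb{Z}_{\ge0}} \mid \exists x\in(\mathbb{R}^n)^{\mathbb{Z}_{\ge0}}$ such that the system equations hold for all $t\in\mathbb{Z}_{\ge0}\}$; the system is called a state-space representation (realization) of $\mathcal{B}$. $\mathsf{LTI}^{m,p}$ is the set of all such behaviors with $m$ inputs and $p$ outputs (any $n$). $n(\mathcal{B})$ is the smallest state dimension among all state-space representations of $\mathcal{B}$; a representation attaining it is minimal. With $\mathcal{O}_0$ the $0\times n$ void matrix (rank $0$) and $\mathcal{O}_k=\begin{pmatrix} C \\ C A \\ \vdots \\ C A^{k-1} \end{pmatrix}$ for $k>0$, the lag is $\ell(\mathcal{B})=\min\{k\in\mathbb{Z}_{\ge0}\mid \operatorname{rank}\mathcal{O}_k=\operatorname{rank}\mathcal{O}_{k+1}\}$, computed from a minimal representation of $\mathcal{B}$. **Restrictions.** $w_{[t_0,t_1]}=(w(t_0),\dots,w(t_1))$ is a stacked column vector, and $\mathcal{B}_{[t_0,t_1]}=\{(u_{[t_0,t_1]},y_{[t_0,t_1]})\mid(u,y)\in\mathcal{B}\}$.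 The notation $(u^{\mathrm{ini}},u^{\mathrm f},y^{\mathrm{ini}},y^{\mathrm f})\in\mathcal{B}_{[0,T_{\mathrm{ini}}+T_{\mathrm f}-1]}$ means that the pair consisting of the concatenated input $(u^{\mathrm{ini}},u^{\mathrm f})$ and concatenated output $(y^{\mathrm{ini}},y^{\mathrm f})$ belongs to the restricted behavior.
   Formalization: The "only if" direction is asserted only for T_f ≥ 1, since for T_f = 0 the void y^f is always the unique continuation even when T_ini < ℓ(B) (e.g. T_ini = T_f = 0, ℓ(B) = 1); the "if" direction is kept for all T_f ≥ 0. *)

theory Defs
  imports "Jordan_Normal_Form.DL_Rank"
begin

type_synonym signal = "nat \<Rightarrow> real vec"

definition signals :: "nat \<Rightarrow> signal set" where
  "signals q = {w. \<forall>t. w t \<in> carrier_vec q}"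

definition behavior ::
  "nat \<Rightarrow> nat \<Rightarrow> nat \<Rightarrow> real mat \<Rightarrow> real mat \<Rightarrow> real mat \<Rightarrow> real mat \<Rightarrow> (signal \<times> signal) set" where
  "behavior m p n A B C D =
     {(u, y). u \<in> signals m \<and> y \<in> signals p \<and>
        (\<exists>x \<in> signals n. \<forall>t. x (t + 1) = A *\<^sub>v x t + B *\<^sub>v u t \<and>
                               y t = C *\<^sub>v x t + D *\<^sub>v u t)}"

definition realizes ::
  "nat \<Rightarrow> nat \<Rightarrow> nat \<Rightarrow> real mat \<Rightarrow> real mat \<Rightarrow> real mat \<Rightarrow> real mat \<Rightarrow> (signal \<times> signal) set \<Rightarrow> bool" where
  "realizes m p n A B C D \<B> \<longleftrightarrow>
     A \<in> carrier_mat n n \<and> B \<in> carrier_mat n m \<and> C \<in> carrier_mat p n \<and> D \<in> carrier_mat p m \<and>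
     \<B> = behavior m p n A B C D"

definition LTI :: "nat \<Rightarrow> nat \<Rightarrow> (signal \<times> signal) set set" where
  "LTI m p = {\<B>. \<exists>n A B C D. realizes m p n A B C D \<B>}"

definition min_state_dim :: "nat \<Rightarrow> nat \<Rightarrow> (signal \<times> signal) set \<Rightarrow> nat" where
  "min_state_dim m p \<B> = (LEAST n. \<exists>A B C D. realizes m p n A B C D \<B>)"

definition minimal_realization ::
  "nat \<Rightarrow> nat \<Rightarrow> nat \<Rightarrow> real mat \<Rightarrow> real mat \<Rightarrow> real mat \<Rightarrow> real mat \<Rightarrow> (signal \<times> signal) set \<Rightarrow> bool" where
  "minimal_realization m p n A B C D \<B> \<longleftrightarrow>
     realizes m p n A B C D \<B> \<and> n = min_state_dim m p \<B>"

(* The rows C, C A, ..., C A^(k-1) stacked from top to bottom; obs_mat A C 0 has no rows. *)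
fun obs_mat :: "real mat \<Rightarrow> real mat \<Rightarrow> nat \<Rightarrow> real mat" where
  "obs_mat A C 0 = 0\<^sub>m 0 (dim_col C)"
| "obs_mat A C (Suc k) = obs_mat A C k @\<^sub>r (C * A ^\<^sub>m k)"

(* The locale parameter of vec_space.rank is the length of the columns, hence dim_row. *)
definition mat_rank :: "real mat \<Rightarrow> nat" where
  "mat_rank M = vec_space.rank (dim_row M) M"

definition obs_lag :: "real mat \<Rightarrow> real mat \<Rightarrow> nat" where
  "obs_lag A C = (LEAST k. mat_rank (obs_mat A C k) = mat_rank (obs_mat A C (k + 1)))"

(* Definite description: the value does not depend on the minimal realization used. *)
definition lag :: "nat \<Rightarrow> nat \<Rightarrow> (signal \<times> signal) set \<Rightarrow> nat" where
  "lag m p \<B> =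
     (THE l. \<exists>n A B C D. minimal_realization m p n A B C D \<B> \<and> l = obs_lag A C)"

(* The stacked vector of the first T samples w(0), ..., w(T-1); it is the void vector for T = 0. *)
fun stack :: "signal \<Rightarrow> nat \<Rightarrow> real vec" where
  "stack w 0 = 0\<^sub>v 0"
| "stack w (Suc T) = stack w T @\<^sub>v w T"

(* Restriction to the time interval [0, T-1]. *)
definition restricted :: "(signal \<times> signal) set \<Rightarrow> nat \<Rightarrow> (real vec \<times> real vec) set" where
  "restricted \<B> T = {(stack u T, stack y T) | u y. (u, y) \<in> \<B>}"

end

theory Submission
  imports Defs "Jordan_Normal_Form.Matrix_Kernel"
begin

text \<open>
  By rank-nullity, the observability matrices of indices \<open>k\<close> and \<open>k + 1\<close> have the same rank iff they
  have the same kernel, that is, iff every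
  zero-input output that vanishes on \<open>[0, k-1]\<close> also vanishes at \<open>k\<close>. This condition
  (\<open>determined\<close> below) mentions only the behavior, so every realization, minimal or not, yields the
  same lag; and it persists from \<open>k\<close> to \<open>k + 1\<close> because the behavior is shift-invariant. By
  causality and linearity, the continuations of a given initial trajectory differ exactly by the
  zero-input outputs that vanish on \<open>[0, Tini - 1]\<close>, so for \<open>Tf > 0\<close> uniqueness is
  this condition at \<open>Tini\<close>.
\<close>

section \<open>Rank and kernel\<close>

text \<open>Rank-nullity for the linear map \<open>v\<close> to \<open>M *\<^sub>v v\<close>: its
  image is the column space, whose dimension is the rank.\<close>

lemma rank_plus_kernel_dim:
  assumes M: "M \<in> carrier_mat nr nc"
  shows "mat_rank M + kernel.dim nc M = nc"
proof -
  interpret V: vec_space "TYPE(real)" nc .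
  interpret W: vec_space "TYPE(real)" nr .
  interpret T: linear_map class_ring "module_vec TYPE(real) nc" "module_vec TYPE(real) nr" "\<lambda>v. M *\<^sub>v v"
  proof (unfold_locales)
    show "(*\<^sub>v) M \<in> LinearCombinations.module_hom class_ring V.V W.V"
      using M by (auto simp: LinearCombinations.module_hom_def module_vec_simps class_ring_simps
        mult_add_distrib_mat_vec mult_mat_vec)
  qed
  have im: "T.imT = W.span (set (cols M))"
    using W.col_space_eq[OF M] M unfolding W.col_space_def T.im_def
    by (auto simp: module_vec_simps)
  have ker: "T.kerT = mat_kernel M"
    unfolding T.ker_def mat_kernel[OF M] by (auto simp: module_vec_simps)
  have "mat_rank M = vectorspace.dim class_ring (W.vs T.imT)"
    using M by (simp add: mat_rank_def W.rank_def im)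
  moreover have "kernel.dim nc M = vectorspace.dim class_ring (V.vs T.kerT)"
    by (simp add: ker)
  ultimately show ?thesis
    using T.rank_nullity[OF V.fin_dim] V.dim_is_n by simp
qed

lemma mat_rank_le_dim_col:
  assumes "M \<in> carrier_mat nr nc"
  shows "mat_rank M \<le> nc"
  using rank_plus_kernel_dim[OF assms] by simp

text \<open>A basis of the smaller kernel stays independent in the larger one; if the dimensions
  agree, it is a basis there too, and both kernels are its span.\<close>

lemma kernel_dim_mono:
  fixes M N :: "real mat"
  assumes M: "M \<in> carrier_mat nr nc" and N: "N \<in> carrier_mat nr' nc"
    and sub: "mat_kernel N \<subseteq> mat_kernel M"
  shows "kernel.dim nc N \<le> kernel.dim nc M"
    and "kernel.dim nc N = kernel.dim nc M \<Longrightarrow> mat_kernel N = mat_kernel M"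
proof -
  interpret M: kernel nr nc M by unfold_locales (rule M)
  interpret N: kernel nr' nc N by unfold_locales (rule N)
  obtain bM where bM: "finite bM" "M.basis bM" using kernel_basis_exists[OF M] by blast
  obtain bN where bN: "finite bN" "N.basis bN" using kernel_basis_exists[OF N] by blast
  have subN: "bN \<subseteq> mat_kernel N" using bN(2) unfolding N.Ker.basis_def by auto
  have fd: "M.Ker.fin_dim"
    using bM unfolding M.Ker.fin_dim_def M.Ker.basis_def by auto
  \<comment> \<open>Independence inside a kernel is independence in the ambient space, which the two
    kernels share.\<close>
  have li: "M.lin_indpt bN"
    using bN(2) subN sub N.lindep_same[OF subN] M.lindep_same[of bN]
    unfolding N.Ker.basis_def by auto
  have dimN: "N.dim = card bN" by (rule N.Ker.dim_basis[OF bN])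
  show "N.dim \<le> M.dim"
    unfolding dimN using M.Ker.li_le_dim(2)[OF fd _ li] subN sub by auto
  assume "N.dim = M.dim"
  then have "M.basis bN"
    using M.Ker.dim_li_is_basis[OF fd bN(1) _ li] subN sub dimN by auto
  then have "mat_kernel M = M.span bN" unfolding M.Ker.basis_def by auto
  also have "\<dots> = N.span bN"
    using M.span_same[of bN] N.span_same[OF subN] subN sub by auto
  also have "\<dots> = mat_kernel N" using bN(2) unfolding N.Ker.basis_def by auto
  finally show "mat_kernel N = mat_kernel M" ..
qed

text \<open>The row counts may differ, so that consecutive observability matrices can be
  compared.\<close>

lemma mat_rank_mono_kernel:
  assumes M: "M \<in> carrier_mat nr nc" and N: "N \<in> carrier_mat nr' nc"
    and sub: "mat_kernel N \<subseteq> mat_kernel M"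
  shows "mat_rank M \<le> mat_rank N"
    and "mat_rank M = mat_rank N \<longleftrightarrow> mat_kernel N = mat_kernel M"
proof -
  note dims = rank_plus_kernel_dim[OF M] rank_plus_kernel_dim[OF N]
  show "mat_rank M \<le> mat_rank N"
    using dims kernel_dim_mono(1)[OF M N sub] by linarith
  have "mat_rank M = mat_rank N \<longleftrightarrow> kernel.dim nc N = kernel.dim nc M"
    using dims by linarith
  also have "\<dots> \<longleftrightarrow> mat_kernel N = mat_kernel M"
    using kernel_dim_mono(2)[OF M N sub] by auto
  finally show "mat_rank M = mat_rank N \<longleftrightarrow> mat_kernel N = mat_kernel M" .
qed

section \<open>Stacked signals\<close>

lemma stack_carrier:
  "(\<And>t. t < T \<Longrightarrow> w t \<in> carrier_vec q) \<Longrightarrow> stack w T \<in> carrier_vec (q * T)"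
proof (induction T)
  case (Suc T)
  then have "stack w T @\<^sub>v w T \<in> carrier_vec (q * T + q)" by (intro append_carrier_vec) auto
  then show ?case by (simp add: add.commute)
qed simp

lemma stack_eq_iff:
  assumes "\<And>t. w t \<in> carrier_vec q" and "\<And>t. w' t \<in> carrier_vec q"
  shows "stack w T = stack w' T \<longleftrightarrow> (\<forall>t<T. w t = w' t)"
proof (induction T)
  case (Suc T)
  have "stack w T \<in> carrier_vec (q * T)" "stack w' T \<in> carrier_vec (q * T)"
    using assms by (auto intro: stack_carrier)
  then show ?case using Suc by (auto simp: append_vec_eq less_Suc_eq)
qed simp

lemma stack_cong: "(\<And>t. t < T \<Longrightarrow> w t = w' t) \<Longrightarrow> stack w T = stack w' T"
  by (induction T) auto

lemma append_vec_assoc: "(u @\<^sub>v v) @\<^sub>v w = u @\<^sub>v (v @\<^sub>v w)"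
  by (intro eq_vecI) auto

lemma stack_add: "stack w (T + S) = stack w T @\<^sub>v stack (\<lambda>t. w (T + t)) S"
proof (induction S)
  case 0
  show ?case by (intro eq_vecI) auto
qed (simp add: append_vec_assoc)

lemma stack_surj:
  "v \<in> carrier_vec (q * T) \<Longrightarrow> \<exists>w\<in>signals q. v = stack w T"
proof (induction T arbitrary: v)
  case 0
  then show ?case by (intro bexI[of _ "\<lambda>_. 0\<^sub>v q"]) (auto simp: signals_def)
next
  case (Suc T)
  have v: "v = vec_first v (q * T) @\<^sub>v vec_last v q"
    using Suc.prems by (intro vec_first_last_append[symmetric]) (simp add: add.commute)
  obtain w where w: "w \<in> signals q" "vec_first v (q * T) = stack w T"
    using Suc.IH[of "vec_first v (q * T)"] by auto
  have "v = stack (w(T := vec_last v q)) (Suc T)"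
    using v w(2) stack_cong[of T w "w(T := vec_last v q)"] by simp
  moreover have "w(T := vec_last v q) \<in> signals q" using w(1) by (auto simp: signals_def)
  ultimately show ?case by blast
qed

section \<open>State-space systems\<close>

primrec state :: "real mat \<Rightarrow> real mat \<Rightarrow> signal \<Rightarrow> real vec \<Rightarrow> signal" where
  "state A B u x0 0 = x0"
| "state A B u x0 (Suc t) = A *\<^sub>v state A B u x0 t + B *\<^sub>v u t"

text \<open>In matrix terms: \<open>C * A ^\<^sub>m k\<close> vanishes on the kernel of
  \<open>obs_mat A C k\<close>.\<close>

definition determined :: "nat \<Rightarrow> nat \<Rightarrow> (signal \<times> signal) set \<Rightarrow> nat \<Rightarrow> bool" where
  "determined m p \<B> k \<longleftrightarrow>
     (\<forall>y. (\<lambda>_. 0\<^sub>v m, y) \<in> \<B> \<longrightarrow> (\<forall>t<k. y t = 0\<^sub>v p) \<longrightarrow> y k = 0\<^sub>v p)"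

text \<open>An arbitrary realization, so that the results apply to minimal ones and to the given one
  alike.\<close>

locale realization =
  fixes m p n :: nat and A B C D :: "real mat" and \<B> :: "(signal \<times> signal) set"
  assumes realizes: "realizes m p n A B C D \<B>"
begin

lemma carrier [simp]:
  "A \<in> carrier_mat n n" "B \<in> carrier_mat n m" "C \<in> carrier_mat p n" "D \<in> carrier_mat p m"
  using realizes unfolding realizes_def by auto

lemma mem_iff:
  "(u, y) \<in> \<B> \<longleftrightarrow> u \<in> signals m \<and> y \<in> signals p \<and>
     (\<exists>x\<in>signals n. \<forall>t. x (Suc t) = A *\<^sub>v x t + B *\<^sub>v u t \<and> y t = C *\<^sub>v x t + D *\<^sub>v u t)"
  using realizes unfolding realizes_def behavior_def by auto

lemma dims [simp]: "dim_row A = n" "dim_col C = n"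
  using carrier_matD[OF carrier(1)] carrier_matD[OF carrier(3)] by auto

lemma memI:
  assumes u: "u \<in> signals m" and x: "x \<in> signals n"
    and next_state: "\<And>t. x (Suc t) = A *\<^sub>v x t + B *\<^sub>v u t"
    and out: "\<And>t. y t = C *\<^sub>v x t + D *\<^sub>v u t"
  shows "(u, y) \<in> \<B>"
proof -
  have "y t \<in> carrier_vec p" for t
    using u x mult_mat_vec_carrier[OF carrier(3)] mult_mat_vec_carrier[OF carrier(4)]
    by (simp add: signals_def out)
  then have "y \<in> signals p" by (simp add: signals_def)
  then show ?thesis unfolding mem_iff using u x next_state out by blast
qed

lemma memD: "(u, y) \<in> \<B> \<Longrightarrow> u t \<in> carrier_vec m" "(u, y) \<in> \<B> \<Longrightarrow> y t \<in> carrier_vec p"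
  by (auto simp: mem_iff signals_def)

lemma state_signal:
  assumes "u \<in> signals m" and "x0 \<in> carrier_vec n"
  shows "state A B u x0 \<in> signals n"
proof -
  have "state A B u x0 t \<in> carrier_vec n" for t
  proof (induction t)
    case (Suc t)
    have "u t \<in> carrier_vec m" using assms(1) by (simp add: signals_def)
    then show ?case
      using Suc mult_mat_vec_carrier[OF carrier(1)] mult_mat_vec_carrier[OF carrier(2)] by simp
  qed (use assms in simp)
  then show ?thesis by (simp add: signals_def)
qed

section \<open>Trajectories from an initial state: causality, superposition, shifts\<close>

lemma state_output_mem:
  assumes "u \<in> signals m" and "x0 \<in> carrier_vec n"
  shows "(u, \<lambda>t. C *\<^sub>v state A B u x0 t + D *\<^sub>v u t) \<in> \<B>"
  by (rule memI[OF assms(1) state_signal[OF assms]]) simp_all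

text \<open>Running the system under \<open>u'\<close> from the initial state of the old trajectory
  reproduces its states up to time \<open>T\<close>, hence its outputs before
  \<open>T\<close>.\<close>

lemma causality:
  assumes "(u, y) \<in> \<B>" and u': "u' \<in> signals m" and eq: "\<And>t. t < T \<Longrightarrow> u' t = u t"
  shows "\<exists>y'. (u', y') \<in> \<B> \<and> (\<forall>t<T. y' t = y t)"
proof -
  obtain x where x: "x \<in> signals n" "\<And>t. x (Suc t) = A *\<^sub>v x t + B *\<^sub>v u t"
      "\<And>t. y t = C *\<^sub>v x t + D *\<^sub>v u t"
    using assms(1) by (auto simp: mem_iff)
  have "state A B u' (x 0) t = x t" if "t \<le> T" for t
    using that by (induction t) (auto simp: x(2) eq)
  then have "\<forall>t<T. C *\<^sub>v state A B u' (x 0) t + D *\<^sub>v u' t = y t"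
    by (auto simp: x(3) eq)
  then show ?thesis
    using state_output_mem[OF u', of "x 0"] x(1) by (auto simp: signals_def)
qed

lemma add_mem:
  assumes "(u, y) \<in> \<B>" and "(u', y') \<in> \<B>"
  shows "(\<lambda>t. u t + u' t, \<lambda>t. y t + y' t) \<in> \<B>"
proof -
  obtain x x' where x: "x \<in> signals n" "\<And>t. x (Suc t) = A *\<^sub>v x t + B *\<^sub>v u t"
      "\<And>t. y t = C *\<^sub>v x t + D *\<^sub>v u t"
    and x': "x' \<in> signals n" "\<And>t. x' (Suc t) = A *\<^sub>v x' t + B *\<^sub>v u' t"
      "\<And>t. y' t = C *\<^sub>v x' t + D *\<^sub>v u' t"
    using assms by (auto simp: mem_iff)
  have [simp]: "x t \<in> carrier_vec n" "x' t \<in> carrier_vec n" "u t \<in> carrier_vec m"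
      "u' t \<in> carrier_vec m" for t
    using x(1) x'(1) assms by (auto simp: signals_def memD)
  have distrib: "(M *\<^sub>v x t + N *\<^sub>v u t) + (M *\<^sub>v x' t + N *\<^sub>v u' t) =
      M *\<^sub>v (x t + x' t) + N *\<^sub>v (u t + u' t)"
    if "M \<in> carrier_mat r n" "N \<in> carrier_mat r m" for M N r t
    using that by (subst (1 2) mult_add_distrib_mat_vec) auto
  show ?thesis
    by (rule memI[of _ "\<lambda>t. x t + x' t"])
      (simp_all add: signals_def x(2,3) x'(2,3) distrib[OF carrier(1,2)] distrib[OF carrier(3,4)])
qed

text \<open>By linearity the common input cancels. This turns two continuations with the same input
  into a zero-input output.\<close>

lemma diff_mem:
  assumes "(u, y) \<in> \<B>" and "(u, y') \<in> \<B>"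
  shows "(\<lambda>_. 0\<^sub>v m, \<lambda>t. y t - y' t) \<in> \<B>"
proof -
  obtain x x' where x: "x \<in> signals n" "\<And>t. x (Suc t) = A *\<^sub>v x t + B *\<^sub>v u t"
      "\<And>t. y t = C *\<^sub>v x t + D *\<^sub>v u t"
    and x': "x' \<in> signals n" "\<And>t. x' (Suc t) = A *\<^sub>v x' t + B *\<^sub>v u t"
      "\<And>t. y' t = C *\<^sub>v x' t + D *\<^sub>v u t"
    using assms by (auto simp: mem_iff)
  have [simp]: "x t \<in> carrier_vec n" "x' t \<in> carrier_vec n" "u t \<in> carrier_vec m" for t
    using x(1) x'(1) assms by (auto simp: signals_def memD)
  have distrib: "(M *\<^sub>v x t + N *\<^sub>v u t) - (M *\<^sub>v x' t + N *\<^sub>v u t) =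
      M *\<^sub>v (x t - x' t) + N *\<^sub>v 0\<^sub>v m"
    if "M \<in> carrier_mat r n" "N \<in> carrier_mat r m" for M N r t
    using that by (subst mult_minus_distrib_mat_vec) (auto intro!: eq_vecI)
  show ?thesis
    by (rule memI[of _ "\<lambda>t. x t - x' t"])
      (simp_all add: signals_def x(2,3) x'(2,3) distrib[OF carrier(1,2)] distrib[OF carrier(3,4)])
qed

text \<open>Time invariance: the shifted state signal solves the same equations.\<close>

lemma shift_mem:
  assumes "(u, y) \<in> \<B>"
  shows "(\<lambda>t. u (t + k), \<lambda>t. y (t + k)) \<in> \<B>"
proof -
  obtain x where x: "x \<in> signals n" "\<And>t. x (Suc t) = A *\<^sub>v x t + B *\<^sub>v u t"
      "\<And>t. y t = C *\<^sub>v x t + D *\<^sub>v u t"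
    using assms by (auto simp: mem_iff)
  then show ?thesis
    using memD(1)[OF assms] by (intro memI[of _ "\<lambda>t. x (t + k)"]) (simp_all add: signals_def)
qed

section \<open>Zero-input outputs and observability matrices\<close>

lemma pow_carrier_vec [simp]: "x0 \<in> carrier_vec n \<Longrightarrow> A ^\<^sub>m t *\<^sub>v x0 \<in> carrier_vec n"
  using mult_mat_vec_carrier[OF pow_carrier_mat[OF carrier(1)]] by simp

text \<open>Matrix powers unfold with the new factor on the right, whereas the state recursion
  applies \<open>A\<close> on the left.\<close>

lemma pow_Suc_mult_vec:
  "x0 \<in> carrier_vec n \<Longrightarrow> A ^\<^sub>m Suc t *\<^sub>v x0 = A *\<^sub>v (A ^\<^sub>m t *\<^sub>v x0)"
proof (induction t arbitrary: x0)
  case 0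
  then show ?case using carrier(1) by simp
next
  case (Suc t)
  have assoc: "A ^\<^sub>m Suc s *\<^sub>v x0 = A ^\<^sub>m s *\<^sub>v (A *\<^sub>v x0)" for s
    using Suc.prems by (simp add: assoc_mult_mat_vec[OF pow_carrier_mat[OF carrier(1)] carrier(1)])
  have "A *\<^sub>v x0 \<in> carrier_vec n" using mult_mat_vec_carrier[OF carrier(1) Suc.prems] .
  from Suc.IH[OF this] show ?case using assoc by metis
qed

lemma mult_zero_vec: "M \<in> carrier_mat r c \<Longrightarrow> M *\<^sub>v 0\<^sub>v c = 0\<^sub>v r" for M :: "real mat"
  by (intro eq_vecI) auto

lemma autonomous_iff:
  "(\<lambda>_. 0\<^sub>v m, y) \<in> \<B> \<longleftrightarrow> (\<exists>x0\<in>carrier_vec n. \<forall>t. y t = C *\<^sub>v (A ^\<^sub>m t *\<^sub>v x0))"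
proof
  assume "(\<lambda>_. 0\<^sub>v m, y) \<in> \<B>"
  then obtain x where x: "\<And>t. x t \<in> carrier_vec n" "\<And>t. x (Suc t) = A *\<^sub>v x t + B *\<^sub>v 0\<^sub>v m"
      "\<And>t. y t = C *\<^sub>v x t + D *\<^sub>v 0\<^sub>v m"
    by (auto simp: mem_iff signals_def)
  have pow: "x t = A ^\<^sub>m t *\<^sub>v x 0" for t
  proof (induction t)
    case 0
    show ?case using x(1)[of 0] by simp
  next
    case (Suc t)
    have "x (Suc t) = A *\<^sub>v x t"
      using x(1)[of t] mult_mat_vec_carrier[OF carrier(1)]
      by (simp add: x(2) mult_zero_vec[OF carrier(2)])
    then show ?case by (simp only: Suc pow_Suc_mult_vec[OF x(1)])
  qed
  have "y t = C *\<^sub>v (A ^\<^sub>m t *\<^sub>v x 0)" for t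
    using x(1)[of t] mult_mat_vec_carrier[OF carrier(3)]
    by (simp add: x(3) mult_zero_vec[OF carrier(4)] flip: pow)
  then show "\<exists>x0\<in>carrier_vec n. \<forall>t. y t = C *\<^sub>v (A ^\<^sub>m t *\<^sub>v x0)"
    using x(1) by blast
next
  assume "\<exists>x0\<in>carrier_vec n. \<forall>t. y t = C *\<^sub>v (A ^\<^sub>m t *\<^sub>v x0)"
  then obtain x0 where x0: "x0 \<in> carrier_vec n" and y: "y = (\<lambda>t. C *\<^sub>v (A ^\<^sub>m t *\<^sub>v x0))" by auto
  have "A ^\<^sub>m Suc t *\<^sub>v x0 = A *\<^sub>v (A ^\<^sub>m t *\<^sub>v x0) + B *\<^sub>v 0\<^sub>v m" for t
    unfolding pow_Suc_mult_vec[OF x0] mult_zero_vec[OF carrier(2)]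
    using mult_mat_vec_carrier[OF carrier(1) pow_carrier_vec[OF x0]] by simp
  moreover have "C *\<^sub>v (A ^\<^sub>m t *\<^sub>v x0) = C *\<^sub>v (A ^\<^sub>m t *\<^sub>v x0) + D *\<^sub>v 0\<^sub>v m" for t
    unfolding mult_zero_vec[OF carrier(4)]
    using mult_mat_vec_carrier[OF carrier(3) pow_carrier_vec[OF x0]] by simp
  ultimately show "(\<lambda>_. 0\<^sub>v m, y) \<in> \<B>"
    unfolding y using pow_carrier_vec[OF x0]
    by (intro memI[of _ "\<lambda>t. A ^\<^sub>m t *\<^sub>v x0"]) (simp_all add: signals_def del: pow_mat.simps)
qed

lemma obs_mat_carrier: "obs_mat A C k \<in> carrier_mat (p * k) n"
proof (induction k)
  case 0
  show ?case by simp
next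
  case (Suc k)
  have "C * A ^\<^sub>m k \<in> carrier_mat p n"
    using mult_carrier_mat[OF carrier(3) pow_carrier_mat[OF carrier(1)]] .
  then have "obs_mat A C (Suc k) \<in> carrier_mat (p * k + p) n"
    using carrier_append_rows[OF Suc] by simp
  then show ?case by (simp add: add.commute)
qed

text \<open>Block row \<open>t\<close> yields sample \<open>t\<close> of the zero-input output
  started in \<open>x\<close>. The kernel thus consists of the initial states whose first
  \<open>k\<close> output samples vanish.\<close>

lemma obs_mat_mult_vec:
  assumes x: "x \<in> carrier_vec n"
  shows "obs_mat A C k *\<^sub>v x = stack (\<lambda>t. C *\<^sub>v (A ^\<^sub>m t *\<^sub>v x)) k"
proof (induction k)
  case 0
  show ?case by (intro eq_vecI) auto
next
  case (Suc k)
  note pow = pow_carrier_mat[OF carrier(1), of k]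
  show ?case
    using mat_mult_append[OF obs_mat_carrier mult_carrier_mat[OF carrier(3) pow] x, of k]
    by (simp add: Suc assoc_mult_mat_vec[OF carrier(3) pow x])
qed

lemma mem_kernel_obs_mat:
  "x \<in> mat_kernel (obs_mat A C k) \<longleftrightarrow>
     x \<in> carrier_vec n \<and> (\<forall>t<k. C *\<^sub>v (A ^\<^sub>m t *\<^sub>v x) = 0\<^sub>v p)"
proof -
  have "stack (\<lambda>_. 0\<^sub>v p) k = 0\<^sub>v (p * k)"
    by (induction k) (auto intro!: eq_vecI simp: add.commute)
  moreover have "C *\<^sub>v (A ^\<^sub>m t *\<^sub>v x) \<in> carrier_vec p" if "x \<in> carrier_vec n" for t
    using mult_mat_vec_carrier[OF carrier(3) pow_carrier_vec[OF that]] .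
  ultimately have "stack (\<lambda>t. C *\<^sub>v (A ^\<^sub>m t *\<^sub>v x)) k = 0\<^sub>v (p * k) \<longleftrightarrow>
      (\<forall>t<k. C *\<^sub>v (A ^\<^sub>m t *\<^sub>v x) = 0\<^sub>v p)" if "x \<in> carrier_vec n"
    using stack_eq_iff[of "\<lambda>t. C *\<^sub>v (A ^\<^sub>m t *\<^sub>v x)" p "\<lambda>_. 0\<^sub>v p" k] that by auto
  then show ?thesis
    unfolding mat_kernel[OF obs_mat_carrier] by (auto simp: obs_mat_mult_vec)
qed

section \<open>Stabilization of the rank and the lag\<close>

lemma kernel_obs_mat_antimono: "mat_kernel (obs_mat A C (k + 1)) \<subseteq> mat_kernel (obs_mat A C k)"
  unfolding subset_iff mem_kernel_obs_mat by auto

lemmas rank_obs_mat_mono =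
  mat_rank_mono_kernel[OF obs_mat_carrier obs_mat_carrier kernel_obs_mat_antimono]

text \<open>The kernels are nested, so equal rank amounts to the reverse inclusion;
  \<open>autonomous_iff\<close> translates initial states into zero-input outputs.\<close>

lemma rank_obs_mat_eq_iff:
  "mat_rank (obs_mat A C k) = mat_rank (obs_mat A C (k + 1)) \<longleftrightarrow> determined m p \<B> k"
proof -
  have "mat_kernel (obs_mat A C (k + 1)) = mat_kernel (obs_mat A C k) \<longleftrightarrow>
      mat_kernel (obs_mat A C k) \<subseteq> mat_kernel (obs_mat A C (k + 1))"
    using kernel_obs_mat_antimono by blast
  also have "\<dots> \<longleftrightarrow> determined m p \<B> k"
    unfolding determined_def autonomous_iff subset_iff mem_kernel_obs_mat
    by (fastforce simp: less_Suc_eq)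
  finally show ?thesis by (simp only: rank_obs_mat_mono(2))
qed

text \<open>The right-hand side no longer mentions the matrices, which makes the lag independent of
  the realization.\<close>

lemma obs_lag_eq: "obs_lag A C = (LEAST k. determined m p \<B> k)"
  unfolding obs_lag_def rank_obs_mat_eq_iff ..

text \<open>Otherwise the rank would grow at every step and reach at least \<open>n + 1\<close> at
  index \<open>n + 1\<close>, although there are only \<open>n\<close> columns.\<close>

lemma determined_exists: "\<exists>k. determined m p \<B> k"
proof (rule ccontr)
  assume "\<nexists>k. determined m p \<B> k"
  then have less: "mat_rank (obs_mat A C k) < mat_rank (obs_mat A C (Suc k))" for k
    using rank_obs_mat_mono(1)[of k] rank_obs_mat_eq_iff[of k] by auto
  have "k \<le> mat_rank (obs_mat A C k)" for k
  proof (induction k)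
    case (Suc k)
    then show ?case using less[of k] by linarith
  qed simp
  then have "Suc n \<le> n"
    using mat_rank_le_dim_col[OF obs_mat_carrier[of "Suc n"]] order_trans by blast
  then show False by simp
qed

text \<open>Dropping the first sample of an output that vanishes on \<open>[0, k]\<close> leaves a
  zero-input output vanishing on \<open>[0, k-1]\<close>; its value at \<open>k\<close> is the one
  in question.\<close>

lemma determined_Suc:
  assumes "determined m p \<B> k"
  shows "determined m p \<B> (Suc k)"
  unfolding determined_def
proof (intro allI impI)
  fix y assume "(\<lambda>_. 0\<^sub>v m, y) \<in> \<B>" and "\<forall>t<Suc k. y t = 0\<^sub>v p"
  then show "y (Suc k) = 0\<^sub>v p"
    using assms shift_mem[of "\<lambda>_. 0\<^sub>v m" y 1] unfolding determined_def by auto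
qed

lemma determined_mono: "k \<le> l \<Longrightarrow> determined m p \<B> k \<Longrightarrow> determined m p \<B> l"
  by (induction rule: dec_induct) (auto intro: determined_Suc)

end

text \<open>The definite description is justified here: a minimal realization exists because the
  least dimension is attained, and all realizations give the same value.\<close>

lemma lag_eq_Least_determined:
  assumes "\<B> \<in> LTI m p"
  shows "lag m p \<B> = (LEAST k. determined m p \<B> k)"
proof -
  have "\<exists>A B C D. realizes m p (min_state_dim m p \<B>) A B C D \<B>"
    unfolding min_state_dim_def by (rule LeastI_ex) (use assms in \<open>auto simp: LTI_def\<close>)
  moreover have "obs_lag A C = (LEAST k. determined m p \<B> k)"
    if "realizes m p n A B C D \<B>" for n A B C D
  proof -
    interpret realization m p n A B C D \<B> by unfold_locales (rule that)
    show ?thesis by (rule obs_lag_eq)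
  qed
  ultimately show ?thesis
    unfolding lag_def minimal_realization_def by (intro the_equality) metis+
qed

text \<open>An upward closed, somewhere true condition holds exactly from its least index
  on.\<close>

lemma (in realization) lag_le_iff: "lag m p \<B> \<le> k \<longleftrightarrow> determined m p \<B> k"
proof -
  have "\<B> \<in> LTI m p" using realizes unfolding LTI_def by blast
  then have lag: "lag m p \<B> = (LEAST k. determined m p \<B> k)" by (rule lag_eq_Least_determined)
  have "determined m p \<B> (lag m p \<B>)" unfolding lag by (rule LeastI_ex) (rule determined_exists)
  then show ?thesis using determined_mono Least_le[of "determined m p \<B>" k] lag by metis
qed

section \<open>Continuations\<close>

context realization
begin

text \<open>Stacks with samples of one common length agree sample by sample. The pair
  \<open>u\<close>, \<open>y\<close> itself may leave the behavior after the window, as a spliced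
  signal can.\<close>

lemma restrictedD:
  assumes "(stack u T, stack y T) \<in> restricted \<B> T"
    and "\<And>t. u t \<in> carrier_vec m" and "\<And>t. y t \<in> carrier_vec p"
  shows "\<exists>u' y'. (u', y') \<in> \<B> \<and> (\<forall>t<T. u' t = u t \<and> y' t = y t)"
proof -
  obtain u' y' where mem: "(u', y') \<in> \<B>" and eq: "stack u T = stack u' T" "stack y T = stack y' T"
    using assms(1) unfolding restricted_def by auto
  have "\<forall>t<T. u t = u' t" "\<forall>t<T. y t = y' t"
    using eq stack_eq_iff[of u m u' T] stack_eq_iff[of y p y' T] assms(2,3) memD[OF mem] by auto
  with mem show ?thesis by auto
qed

lemma continuation_exists:
  assumes "(uini, yini) \<in> restricted \<B> T" and "uf \<in> carrier_vec (m * S)"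
  shows "\<exists>u y. (u, y) \<in> \<B> \<and> uini = stack u T \<and> yini = stack y T \<and>
    uf = stack (\<lambda>t. u (T + t)) S"
proof -
  obtain u y where uy: "(u, y) \<in> \<B>" "uini = stack u T" "yini = stack y T"
    using assms(1) unfolding restricted_def by auto
  obtain v where v: "v \<in> signals m" "uf = stack v S" using stack_surj[OF assms(2)] by blast
  \<comment> \<open>The past of \<open>u\<close> followed by the prescribed future; by causality the
    first \<open>T\<close> outputs survive.\<close>
  define u' where "u' t = (if t < T then u t else v (t - T))" for t
  have "u' \<in> signals m"
    using memD(1)[OF uy(1)] v(1) by (auto simp: u'_def signals_def)
  then obtain y' where "(u', y') \<in> \<B>" "\<forall>t<T. y' t = y t"
    using causality[OF uy(1), of u' T] by (auto simp: u'_def)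
  moreover have "uini = stack u' T" "uf = stack (\<lambda>t. u' (T + t)) S"
    unfolding uy v by (auto intro!: stack_cong simp: u'_def)
  moreover have "yini = stack y' T"
    unfolding uy(3) using calculation by (auto intro: stack_cong)
  ultimately show ?thesis by blast
qed

text \<open>The continuations form a translate, based at the one given by \<open>y\<close>, of the
  linear space of zero-input outputs vanishing before \<open>T\<close>.\<close>

lemma continuation_iff:
  assumes mem: "(u, y) \<in> \<B>"
  shows "yf \<in> carrier_vec (p * S) \<and>
      (stack u T @\<^sub>v stack (\<lambda>t. u (T + t)) S, stack y T @\<^sub>v yf) \<in> restricted \<B> (T + S) \<longleftrightarrow>
    (\<exists>e. (\<lambda>_. 0\<^sub>v m, e) \<in> \<B> \<and> (\<forall>t<T. e t = 0\<^sub>v p) \<and>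
      yf = stack (\<lambda>t. y (T + t) + e (T + t)) S)"
    (is "?L \<longleftrightarrow> ?R")
proof
  note [simp] = memD[OF mem]
  assume L: ?L
  then obtain f where f: "f \<in> signals p" "yf = stack f S" using stack_surj by blast
  \<comment> \<open>Only the window \<open>[0, T+S-1]\<close> of \<open>g\<close> is known to come
    from a trajectory.\<close>
  define g where "g t = (if t < T then y t else f (t - T))" for t
  have g: "g t \<in> carrier_vec p" for t using f(1) by (auto simp: g_def signals_def)
  have "stack y T @\<^sub>v yf = stack g (T + S)"
    unfolding stack_add f(2) g_def by (auto intro!: arg_cong2[of _ _ _ _ append_vec] stack_cong)
  with L have "(stack u (T + S), stack g (T + S)) \<in> restricted \<B> (T + S)"
    by (simp add: stack_add)
  then obtain u1 y1 where 1: "(u1, y1) \<in> \<B>" "\<forall>t<T+S. u1 t = u t \<and> y1 t = g t"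
    using restrictedD[of u "T + S" g] memD(1)[OF mem] g by blast
  \<comment> \<open>\<open>u1\<close> matches \<open>u\<close> only on the window. Causality
    replaces it by \<open>u\<close> itself, so that \<open>y2 - y\<close> is a zero-input output and
    serves as \<open>e\<close>.\<close>
  then obtain y2 where 2: "(u, y2) \<in> \<B>" "\<forall>t<T+S. y2 t = y1 t"
    using causality[OF 1(1), of u "T + S"] mem by (auto simp: mem_iff)
  note [simp] = memD(2)[OF 2(1)]
  have "y2 t - y t = 0\<^sub>v p" if "t < T" for t using that 1 2 by (simp add: g_def)
  moreover have "y t + (y2 t - y t) = y2 t" for t
    by (intro eq_vecI)
      (simp_all add: carrier_vecD[OF memD(2)[OF mem]] carrier_vecD[OF memD(2)[OF 2(1)]])
  moreover have "yf = stack (\<lambda>t. y2 (T + t)) S"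
    unfolding f(2) using 1 2 by (auto intro!: stack_cong simp: g_def)
  ultimately show ?R using diff_mem[OF 2(1) mem] by auto
next
  note [simp] = memD[OF mem]
  assume ?R
  then obtain e where e: "(\<lambda>_. 0\<^sub>v m, e) \<in> \<B>" "\<forall>t<T. e t = 0\<^sub>v p"
    and yf: "yf = stack (\<lambda>t. y (T + t) + e (T + t)) S" by blast
  have "(u, \<lambda>t. y t + e t) \<in> \<B>" using add_mem[OF mem e(1)] by simp
  moreover have "stack (\<lambda>t. y t + e t) T = stack y T" using e(2) by (auto intro!: stack_cong)
  ultimately have "(stack u (T + S), stack y T @\<^sub>v yf) \<in> restricted \<B> (T + S)"
    unfolding restricted_def yf
    by (intro CollectI exI[of _ u] exI[of _ "\<lambda>t. y t + e t"]) (simp add: stack_add)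
  then show ?L using memD(2)[OF e(1)] unfolding yf by (auto simp: stack_add intro!: stack_carrier)
qed

text \<open>The condition persists at every \<open>t\<close> from \<open>T\<close> on, so strong
  induction carries the zeros forward indefinitely.\<close>

lemma determined_imp_zero:
  assumes "determined m p \<B> T" and e: "(\<lambda>_. 0\<^sub>v m, e) \<in> \<B>" "\<forall>t<T. e t = 0\<^sub>v p"
  shows "e t = 0\<^sub>v p"
proof (induction t rule: less_induct)
  case (less t)
  show ?case
  proof (cases "t < T")
    case False
    then have "determined m p \<B> t" using determined_mono[of T t] assms(1) by simp
    then show ?thesis using less e(1) unfolding determined_def by blast
  qed (use e in simp)
qed

text \<open>The possible deviations do not depend on the chosen trajectory, so uniqueness for this
  single past already gives the condition at \<open>T\<close>. A nonempty future is needed for that,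
  since a void one is always unique.\<close>

lemma unique_continuation:
  fixes T S :: nat
  assumes mem: "(u, y) \<in> \<B>"
  defines "P \<equiv> \<lambda>yf. yf \<in> carrier_vec (p * S) \<and>
      (stack u T @\<^sub>v stack (\<lambda>t. u (T + t)) S, stack y T @\<^sub>v yf) \<in> restricted \<B> (T + S)"
  shows "determined m p \<B> T \<Longrightarrow> \<exists>!yf. P yf"
    and "0 < S \<Longrightarrow> \<exists>!yf. P yf \<Longrightarrow> determined m p \<B> T"
proof -
  note [simp] = memD[OF mem]
  \<comment> \<open>The zero deviation, which makes the future of \<open>y\<close> itself a
    continuation.\<close>
  have zero_mem: "(\<lambda>_. 0\<^sub>v m, \<lambda>_. 0\<^sub>v p) \<in> \<B>"
    using diff_mem[OF mem mem] minus_cancel_vec[OF memD(2)[OF mem]] by simp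
  then have P_y: "P (stack (\<lambda>t. y (T + t)) S)"
    unfolding P_def continuation_iff[OF mem] by (intro exI[of _ "\<lambda>_. 0\<^sub>v p"]) simp
  show "\<exists>!yf. P yf" if det: "determined m p \<B> T"
  proof (intro ex1I[of P, OF P_y])
    fix yf assume "P yf"
    then obtain e where e: "(\<lambda>_. 0\<^sub>v m, e) \<in> \<B>" "\<forall>t<T. e t = 0\<^sub>v p"
      and yf: "yf = stack (\<lambda>t. y (T + t) + e (T + t)) S"
      unfolding P_def continuation_iff[OF mem] by blast
    show "yf = stack (\<lambda>t. y (T + t)) S"
      by (simp add: yf determined_imp_zero[OF det e])
  qed
  show "determined m p \<B> T" if S: "0 < S" and unique: "\<exists>!yf. P yf"
    unfolding determined_def
  proof (intro allI impI)
    fix e assume e: "(\<lambda>_. 0\<^sub>v m, e) \<in> \<B>" "\<forall>t<T. e t = 0\<^sub>v p"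
    note [simp] = memD(2)[OF e(1)]
    have "P (stack (\<lambda>t. y (T + t) + e (T + t)) S)"
      unfolding P_def continuation_iff[OF mem] using e by blast
    then have "stack (\<lambda>t. y (T + t) + e (T + t)) S = stack (\<lambda>t. y (T + t)) S"
      using unique P_y by blast
    \<comment> \<open>The first sample of the future, which exists because \<open>0 < S\<close>, is
      the one at time \<open>T\<close>.\<close>
    then have "y T + e T = y T"
      using S stack_eq_iff[of "\<lambda>t. y (T + t) + e (T + t)" p "\<lambda>t. y (T + t)" S] by auto
    then have "y T $ i + e T $ i = y T $ i" if "i < p" for i
      using that index_add_vec(1)[of i "e T" "y T"] by (simp add: carrier_vecD[of _ p])
    then show "e T = 0\<^sub>v p" by (intro eq_vecI) (auto simp: carrier_vecD[of _ p])
  qed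
qed

end

text \<open>The equivalence is guarded by \<open>0 < Tf\<close>: for \<open>Tf = 0\<close> the void
  vector is the unique continuation even when \<open>Tini\<close> is below the lag, so there only
  the implication from the lag bound can hold in general.\<close>

theorem lemma2:
  fixes m p n Tini Tf :: nat
    and A B C D :: "real mat"
    and \<B> :: "(signal \<times> signal) set"
    and uini yini uf :: "real vec"
  assumes "\<B> \<in> LTI m p"
    and "realizes m p n A B C D \<B>"
    and "(uini, yini) \<in> restricted \<B> Tini"
    and "uf \<in> carrier_vec (m * Tf)"
  shows "(lag m p \<B> \<le> Tini \<longrightarrow>
            (\<exists>!yf. yf \<in> carrier_vec (p * Tf) \<and>
                   (uini @\<^sub>v uf, yini @\<^sub>v yf) \<in> restricted \<B> (Tini + Tf))) \<and>
         (0 < Tf \<longrightarrow>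
            ((\<exists>!yf. yf \<in> carrier_vec (p * Tf) \<and>
                    (uini @\<^sub>v uf, yini @\<^sub>v yf) \<in> restricted \<B> (Tini + Tf))
             \<longleftrightarrow> lag m p \<B> \<le> Tini))"
proof -
  interpret realization m p n A B C D \<B> by unfold_locales (rule assms(2))
  obtain u y where uy: "(u, y) \<in> \<B>" "uini = stack u Tini" "yini = stack y Tini"
      "uf = stack (\<lambda>t. u (Tini + t)) Tf"
    using continuation_exists[OF assms(3,4)] by blast
  show ?thesis
    unfolding lag_le_iff uy(2-4) using unique_continuation[OF uy(1)] by blast
qed

end
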